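(* Let $x$ be a complex number and $n$ a positive integer such that all quantities below are defined. Then \[ \sum_{k=0}^n\binom{2n-k}{n}\binom{x+k}{k}kH^2_{k}(x)=\frac{x+1}{8}\binom{x+2n+1}{n-1} \Big\{8H_{n+2}^{\langle2\rangle}(x)-4H_{2n}^{\langle2\rangle}(x+1) +8\big[H_{n+2}(x)-H_{2n+1}(x)\big]\big[H_{n+2}(x)-H_{2n+1}(x)-\tfrac{2}{x+1}\big] -\big[H_n(\tfrac{x}{2})-H_n(\tfrac{x+1}{2})\big]\big[H_n(\tfrac{x}{2})-H_n(\tfrac{x+1}{2})+\tfrac{4}{n}\big]\Big\}. \]
   Context: For a complex $y$ and an integer $k\ge 0$, $\binom{y}{k}=\frac{y(y-1)\cdots(y-k+1)}{k!}$. For complex $x$, integer $n\ge 0$ and positive integer $\ell$: $H_0^{\langle\ell\rangle}(x)=0$, $H_n^{\langle\ell\rangle}(x)=\sum_{k=1}^n\frac{1}{(x+k)^\ell}$, and $H_n(x)=H_n^{\langle1\rangle}(x)$; $H_n^2(x)$ denotes $(H_n(x))^2$. *)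

theory Defs
  imports Complex_Main
begin

definition gharm :: "nat \<Rightarrow> nat \<Rightarrow> complex \<Rightarrow> complex" where
  "gharm l n x = (\<Sum>k = 1..n. 1 / (x + of_nat k) ^ l)"

abbreviation gharm1 :: "nat \<Rightarrow> complex \<Rightarrow> complex" where
  "gharm1 \<equiv> gharm 1"

end

theory Submission
  imports Defs
begin

text \<open>
  Let \<open>F(t) = \<Sum>\<^sub>k binom (y + k) k \<cdot> g\<^sub>k t\<^sup>k\<close>.  The sum
  \<open>T(m, N) = \<Sum>\<^sub>k binom (m + N - k) m \<cdot> binom (y + k) k \<cdot> g\<^sub>k\<close> is the coefficient of \<open>t\<^sup>N\<close> in
  \<open>F(t) / (1 - t)\<^sup>m\<^sup>+\<^sup>1\<close>, and \<open>(1 - t) F' - (y + 1) F\<close> is the series of the same shape with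
  \<open>(y + k + 1) (g\<^sub>k\<^sub>+\<^sub>1 - g\<^sub>k)\<close> in place of \<open>g\<^sub>k\<close>; this gives first-order recurrences for \<open>T\<close>.
  The weights \<open>1\<close>, \<open>H\<^sub>k\<close> and \<open>H\<^sub>k\<^sup>2 - H\<^sub>k\<^sup>\<langle>\<^sup>2\<^sup>\<rangle>\<close> belong to \<open>(1 - t)\<^sup>-\<^sup>y\<^sup>-\<^sup>1\<close> and its
  derivatives in \<open>y\<close>, and for them the recurrence in \<open>N\<close> is solved for all \<open>m\<close> and \<open>N\<close>.
  The remaining part \<open>H\<^sub>k\<^sup>\<langle>\<^sup>2\<^sup>\<rangle>\<close> of \<open>H\<^sub>k\<^sup>2\<close> has the inhomogeneity \<open>g\<^sub>k = 1 / (y + k + 1)\<close>.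
  For these two weights the diagonal \<open>m = N\<close> is climbed by alternating unit steps in \<open>m\<close> and \<open>N\<close>,
  each of which adjoins one term to the alternating harmonic sum \<open>\<Sum>\<^sub>k (-1)\<^sup>k\<^sup>+\<^sup>1 / (y + k)\<close>;
  this sum is where \<open>H\<^sub>n(x/2) - H\<^sub>n((x+1)/2)\<close> comes from.
\<close>

section \<open>Harmonic sums\<close>

lemma gharm_0 [simp]: "gharm l 0 x = 0"
  by (simp add: gharm_def)

lemma gharm_Suc: "gharm l (Suc n) x = gharm l n x + 1 / (x + of_nat n + 1) ^ l"
  by (simp add: gharm_def add_ac)

lemma gharm_1 [simp]: "gharm l (Suc 0) x = 1 / (x + 1) ^ l"
  by (simp add: gharm_Suc)

lemma gharm_add: "gharm l (m + n) x = gharm l m x + gharm l n (x + of_nat m)"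
  by (induction n) (simp_all add: gharm_Suc add_ac)

definition alt_harm :: "nat \<Rightarrow> 'a \<Rightarrow> 'a::field" where
  "alt_harm n y = (\<Sum>k = 1..n. (- 1) ^ (k + 1) / (y + of_nat k))"

lemma alt_harm_0 [simp]: "alt_harm 0 y = 0"
  by (simp add: alt_harm_def)

lemma alt_harm_Suc: "alt_harm (Suc n) y = alt_harm n y + (- 1) ^ n / (y + of_nat n + 1)"
  by (simp add: alt_harm_def add_ac)

lemma gharm1_half_diff: "gharm1 n (x / 2) - gharm1 n ((x + 1) / 2) = 2 * alt_harm (2 * n) (x + 1)"
proof (induction n)
  case (Suc n)
  have halves: "x / 2 + of_nat n + 1 = (x + 2 * of_nat n + 2) / 2"
    "(x + 1) / 2 + of_nat n + 1 = (x + 2 * of_nat n + 3) / 2"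
    by (simp_all add: field_simps)
  have "gharm1 (Suc n) (x / 2) - gharm1 (Suc n) ((x + 1) / 2)
      = 2 * alt_harm (2 * n) (x + 1) + (2 / (x + 2 * of_nat n + 2) - 2 / (x + 2 * of_nat n + 3))"
    unfolding Suc.IH[symmetric] gharm_Suc halves by simp
  then show ?case
    by (simp add: alt_harm_Suc add_ac distrib_left)
qed simp

lemma alt_harm_odd:
  "alt_harm (2 * n + 1) y = alt_harm (2 * n) y + 1 / (y + 2 * of_nat n + 1)"
  using alt_harm_Suc[of "2 * n" y] by simp

lemma alt_harm_even:
  "alt_harm (2 * n + 2) y = alt_harm (2 * n + 1) y - 1 / (y + 2 * of_nat n + 2)"
  using alt_harm_Suc[of "2 * n + 1" y] by (simp add: add_ac)

text \<open>By Newton's identity, minus the second elementary symmetric polynomial of the terms of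
  \<open>alt_harm n y\<close>.\<close>

definition alt_harm_defect :: "nat \<Rightarrow> complex \<Rightarrow> complex" where
  "alt_harm_defect n y = (gharm 2 n y - (alt_harm n y)\<^sup>2) / 2"

lemma alt_harm_defect_0 [simp]: "alt_harm_defect 0 y = 0"
  by (simp add: alt_harm_defect_def)

lemma alt_harm_defect_Suc:
  "alt_harm_defect (Suc n) y
    = alt_harm_defect n y - (- 1) ^ n * alt_harm n y / (y + of_nat n + 1)"
proof -
  define s where "s = (- 1) ^ n / (y + of_nat n + 1)"
  have "s\<^sup>2 = 1 / (y + of_nat n + 1)\<^sup>2"
    by (simp add: s_def power_divide flip: power_mult)
  then have "alt_harm_defect (Suc n) y = (gharm 2 n y + s\<^sup>2 - (alt_harm n y + s)\<^sup>2) / 2"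
    by (simp add: alt_harm_defect_def gharm_Suc alt_harm_Suc s_def)
  also have "\<dots> = alt_harm_defect n y - s * alt_harm n y"
    by (simp add: alt_harm_defect_def power2_sum field_simps)
  finally show ?thesis
    by (simp add: s_def)
qed

lemma alt_harm_defect_odd:
  "alt_harm_defect (2 * n + 1) y
    = alt_harm_defect (2 * n) y - alt_harm (2 * n) y / (y + 2 * of_nat n + 1)"
  using alt_harm_defect_Suc[of "2 * n" y] by simp

lemma alt_harm_defect_even:
  "alt_harm_defect (2 * n + 2) y
    = alt_harm_defect (2 * n + 1) y + alt_harm (2 * n + 1) y / (y + 2 * of_nat n + 2)"
  using alt_harm_defect_Suc[of "2 * n + 1" y] by (simp add: add_ac)

section \<open>Binomial sums and their recurrences\<close>

definition binomial_sum :: "'a \<Rightarrow> (nat \<Rightarrow> 'a) \<Rightarrow> nat \<Rightarrow> nat \<Rightarrow> 'a::field_char_0" where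
  "binomial_sum y g m N
    = (\<Sum>k\<le>N. of_nat ((m + N - k) choose m) * ((y + of_nat k) gchoose k) * g k)"

definition weighted_diff :: "'a \<Rightarrow> (nat \<Rightarrow> 'a) \<Rightarrow> nat \<Rightarrow> 'a::comm_ring_1" where
  "weighted_diff y g k = (y + of_nat k + 1) * (g (Suc k) - g k)"

lemma binomial_sum_cong:
  "(\<And>k. k \<le> N \<Longrightarrow> f k = g k) \<Longrightarrow> binomial_sum y f m N = binomial_sum y g m N"
  by (simp add: binomial_sum_def)

lemma binomial_sum_add:
  "binomial_sum y (\<lambda>k. f k + g k) m N = binomial_sum y f m N + binomial_sum y g m N"
  by (simp add: binomial_sum_def distrib_left sum.distrib)

lemma binomial_sum_cmult: "binomial_sum y (\<lambda>k. c * g k) m N = c * binomial_sum y g m N"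
  by (simp add: binomial_sum_def sum_distrib_left mult_ac)

lemma binomial_sum_0_right [simp]: "binomial_sum y g m 0 = g 0"
  by (simp add: binomial_sum_def)

lemma binomial_sum_Pascal:
  "binomial_sum y g (Suc m) (Suc N) = binomial_sum y g (Suc m) N + binomial_sum y g m (Suc N)"
proof -
  have "binomial_sum y g (Suc m) (Suc N)
      = (\<Sum>k\<le>Suc N. of_nat ((m + Suc N - k) choose Suc m) * ((y + of_nat k) gchoose k) * g k)
        + binomial_sum y g m (Suc N)"
    unfolding binomial_sum_def sum.distrib[symmetric]
  proof (rule sum.cong)
    fix k assume "k \<in> {..Suc N}"
    then have "Suc m + Suc N - k = Suc (m + Suc N - k)"
      by auto
    then show "of_nat ((Suc m + Suc N - k) choose Suc m) * ((y + of_nat k) gchoose k) * g k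
      = of_nat ((m + Suc N - k) choose Suc m) * ((y + of_nat k) gchoose k) * g k
        + of_nat ((m + Suc N - k) choose m) * ((y + of_nat k) gchoose k) * g k"
      by (simp only: binomial_Suc_Suc of_nat_add distrib_right add.commute)
  qed simp
  then show ?thesis
    by (simp add: binomial_sum_def)
qed

lemma binomial_sum_Suc_left_absorb:
  "of_nat (Suc m) * binomial_sum y g (Suc m) N
    = binomial_sum y (\<lambda>k. (of_nat (m + N) + 1 - of_nat k) * g k) m N"
  for y :: "'a::field_char_0"
  unfolding binomial_sum_def sum_distrib_left
proof (intro sum.cong refl)
  fix k assume "k \<in> {..N}"
  then have bounds: "k \<le> m + N" "Suc m + N - k = Suc (m + N - k)"
    by auto
  have "of_nat (Suc m) * of_nat (Suc (m + N - k) choose Suc m)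
      = (of_nat (Suc (m + N - k)) * of_nat ((m + N - k) choose m) :: 'a)"
    unfolding of_nat_mult[symmetric] Suc_times_binomial ..
  also have "(of_nat (Suc (m + N - k)) :: 'a) = of_nat (m + N) + 1 - of_nat k"
    using bounds(1) by (simp add: of_nat_diff)
  finally show "of_nat (Suc m)
        * (of_nat ((Suc m + N - k) choose Suc m) * ((y + of_nat k) gchoose k) * g k)
      = of_nat ((m + N - k) choose m) * ((y + of_nat k) gchoose k)
        * ((of_nat (m + N) + 1 - of_nat k) * g k)"
    unfolding bounds(2) mult.assoc[symmetric] by (simp only: mult_ac)
qed

lemma binomial_sum_Suc_right_absorb:
  "binomial_sum y (\<lambda>k. (of_nat (Suc N) - of_nat k) * g k) m (Suc N)
    = binomial_sum y (\<lambda>k. (of_nat (m + N) + 1 - of_nat k) * g k) m N"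
  for y :: "'a::field_char_0"
proof -
  have "binomial_sum y (\<lambda>k. (of_nat (Suc N) - of_nat k) * g k) m (Suc N)
      = (\<Sum>k\<le>N. of_nat ((m + Suc N - k) choose m) * ((y + of_nat k) gchoose k)
          * ((of_nat (Suc N) - of_nat k) * g k))"
    unfolding binomial_sum_def sum.atMost_Suc by simp
  also have "\<dots> = binomial_sum y (\<lambda>k. (of_nat (m + N) + 1 - of_nat k) * g k) m N"
    unfolding binomial_sum_def
  proof (intro sum.cong refl)
    fix k assume "k \<in> {..N}"
    then obtain j where j: "N = k + j"
      using le_Suc_ex by auto
    have "Suc j * (Suc (m + j) choose m) = Suc (m + j) * ((m + j) choose m)"
      using binomial_absorb_comp[of "Suc (m + j)" m] by (simp add: Suc_diff_le)
    then have "of_nat (Suc j) * of_nat (Suc (m + j) choose m)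
        = (of_nat (Suc (m + j)) * of_nat ((m + j) choose m) :: 'a)"
      unfolding of_nat_mult[symmetric] by (simp only:)
    then have "of_nat ((m + Suc N - k) choose m) * (of_nat (Suc N) - of_nat k)
        = (of_nat ((m + N - k) choose m) * (of_nat (m + N) + 1 - of_nat k) :: 'a)"
      by (simp add: j algebra_simps)
    then show "of_nat ((m + Suc N - k) choose m) * ((y + of_nat k) gchoose k)
          * ((of_nat (Suc N) - of_nat k) * g k)
        = of_nat ((m + N - k) choose m) * ((y + of_nat k) gchoose k)
          * ((of_nat (m + N) + 1 - of_nat k) * g k)"
      by (simp only: mult_ac)
  qed
  finally show ?thesis .
qed

lemma binomial_sum_index_absorb:
  "binomial_sum y (\<lambda>k. of_nat k * g k) m (Suc N)
    = binomial_sum y (\<lambda>k. (y + of_nat k + 1) * g (Suc k)) m N"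
proof -
  have "binomial_sum y (\<lambda>k. of_nat k * g k) m (Suc N)
      = (\<Sum>k\<le>N. of_nat ((m + N - k) choose m)
          * (of_nat (Suc k) * ((y + of_nat k + 1) gchoose Suc k)) * g (Suc k))"
    unfolding binomial_sum_def sum.atMost_Suc_shift by (simp add: mult_ac add_ac)
  then show ?thesis
    unfolding Suc_times_gbinomial binomial_sum_def by (simp only: mult_ac)
qed

lemma binomial_sum_Suc_left:
  "of_nat (Suc m) * binomial_sum y g (Suc m) N
    = (y + of_nat (m + N) + 2) * binomial_sum y g m N
      - binomial_sum y (\<lambda>k. (y + of_nat k + 1) * g k) m N"
proof -
  have "(y + of_nat (m + N) + 2) * binomial_sum y g m N
      = binomial_sum y (\<lambda>k. (of_nat (m + N) + 1 - of_nat k) * g k + (y + of_nat k + 1) * g k) m N"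
    unfolding binomial_sum_cmult[symmetric]
    by (rule binomial_sum_cong) (simp add: algebra_simps)
  then show ?thesis
    by (simp only: binomial_sum_Suc_left_absorb binomial_sum_add add_diff_cancel_right')
qed

lemma binomial_sum_Suc_right:
  "of_nat (Suc N) * binomial_sum y g m (Suc N)
    = (y + of_nat (m + N) + 2) * binomial_sum y g m N + binomial_sum y (weighted_diff y g) m N"
proof -
  have "of_nat (Suc N) * binomial_sum y g m (Suc N)
      = binomial_sum y (\<lambda>k. (of_nat (Suc N) - of_nat k) * g k + of_nat k * g k) m (Suc N)"
    unfolding binomial_sum_cmult[symmetric]
    by (rule binomial_sum_cong) (simp add: algebra_simps)
  also have "\<dots> = binomial_sum y (\<lambda>k. (of_nat (m + N) + 1 - of_nat k) * g k
      + (y + of_nat k + 1) * g (Suc k)) m N"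
    by (simp only: binomial_sum_add binomial_sum_Suc_right_absorb binomial_sum_index_absorb)
  also have "\<dots> = binomial_sum y (\<lambda>k. (y + of_nat (m + N) + 2) * g k + weighted_diff y g k) m N"
    by (rule binomial_sum_cong) (simp add: weighted_diff_def algebra_simps)
  finally show ?thesis
    by (simp only: binomial_sum_add binomial_sum_cmult)
qed

lemma binomial_sum_Suc_exchange:
  "of_nat (Suc N) * binomial_sum y g m (Suc N)
    = (y + of_nat m + 2) * binomial_sum y g (Suc m) N
      + binomial_sum y (weighted_diff y g) (Suc m) N"
  using binomial_sum_Suc_right[of N y g "Suc m"] binomial_sum_Pascal[of y g m N]
  by (simp add: algebra_simps)

lemma binomial_sum_Suc_Suc:
  "(y + of_nat m + 2) * binomial_sum y g (Suc m) (Suc N)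
    = (y + of_nat (m + N) + 3) * binomial_sum y g m (Suc N)
      - binomial_sum y (weighted_diff y g) (Suc m) N"
  unfolding binomial_sum_Pascal using binomial_sum_Suc_exchange[of N y g m]
  by (simp add: algebra_simps)

lemma binomial_sum_shift:
  "binomial_sum y (\<lambda>k. (y + of_nat k + 1) * g k) m N = (y + 1) * binomial_sum (y + 1) g m N"
proof -
  have "((y + of_nat k) gchoose k) * ((y + of_nat k + 1) * g k)
      = (y + 1) * (((y + 1 + of_nat k) gchoose k) * g k)" for k
    using gbinomial_absorb_comp[of "y + of_nat k + 1" k] by (simp add: algebra_simps)
  then show ?thesis
    unfolding binomial_sum_def sum_distrib_left mult.assoc by (simp only: mult.left_commute)
qed

section \<open>Closed forms for constant and harmonic weights\<close>

text \<open>Variation of constants: the homogeneous recurrence in \<open>N\<close> is solved by the binomial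
  coefficient.\<close>

lemma binomial_sum_eqI:
  assumes "g 0 = f 0"
    and "\<And>M. M < N \<Longrightarrow> binomial_sum y (weighted_diff y g) m M
      = ((y + of_nat (m + M) + 1) gchoose M) * weighted_diff (y + of_nat m + 1) f M"
  shows "binomial_sum y g m N = ((y + of_nat (m + N) + 1) gchoose N) * f N"
  using assms(2)
proof (induction N)
  case (Suc N)
  let ?a = "y + of_nat (m + N) + 1"
  have inhomogeneity: "binomial_sum y (weighted_diff y g) m N
      = (?a gchoose N) * ((?a + 1) * (f (Suc N) - f N))"
    using Suc.prems[of N] unfolding weighted_diff_def[of "y + of_nat m + 1"] by (simp add: add_ac)
  have "of_nat (Suc N) * binomial_sum y g m (Suc N)
      = (?a + 1) * ((?a gchoose N) * f N) + (?a gchoose N) * ((?a + 1) * (f (Suc N) - f N))"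
    unfolding binomial_sum_Suc_right inhomogeneity using Suc by (simp add: add_ac)
  also have "\<dots> = (?a + 1) * (?a gchoose N) * f (Suc N)"
    by (simp add: algebra_simps)
  also have "\<dots> = of_nat (Suc N) * (((?a + 1) gchoose Suc N) * f (Suc N))"
    unfolding Suc_times_gbinomial[symmetric] by (simp only: mult.assoc)
  also have "?a + 1 = y + of_nat (m + Suc N) + 1"
    by simp
  finally show ?case
    by (simp del: of_nat_Suc of_nat_add add_Suc_right)
qed (simp add: assms(1))

lemma binomial_sum_one: "binomial_sum y (\<lambda>k. 1) m N = ((y + of_nat (m + N) + 1) gchoose N)"
proof -
  have "weighted_diff z (\<lambda>k. 1) = (\<lambda>k. 0)" for z :: 'a
    by (simp add: weighted_diff_def fun_eq_iff)
  then show ?thesis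
    using binomial_sum_eqI[of "\<lambda>k. 1" "\<lambda>k. 1" N y m] by (simp add: binomial_sum_def)
qed

lemma weighted_diff_gharm:
  assumes "y + of_nat k + 1 \<noteq> 0" "l \<ge> 1"
  shows "weighted_diff y (\<lambda>k. gharm l k y) k = 1 / (y + of_nat k + 1) ^ (l - 1)"
  using assms by (cases l) (simp_all add: weighted_diff_def gharm_Suc)

lemma weighted_diff_gharm1_square_minus_gharm2:
  assumes "y + of_nat k + 1 \<noteq> 0"
  shows "weighted_diff y (\<lambda>k. (gharm1 k y)\<^sup>2 - gharm 2 k y) k = 2 * gharm1 k y"
proof -
  define r where "r = 1 / (y + of_nat k + 1)"
  have "weighted_diff y (\<lambda>k. (gharm1 k y)\<^sup>2 - gharm 2 k y) k
      = (y + of_nat k + 1) * r * (2 * gharm1 k y)"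
    by (simp add: weighted_diff_def gharm_Suc power_divide)
      (simp add: r_def power_divide algebra_simps power2_eq_square)
  then show ?thesis
    using assms by (simp add: r_def)
qed

lemma binomial_sum_gharm1:
  assumes "\<And>k. k \<in> {1..m + N + 1} \<Longrightarrow> y + of_nat k \<noteq> 0"
  shows "binomial_sum y (\<lambda>k. gharm1 k y) m N
    = ((y + of_nat (m + N) + 1) gchoose N) * gharm1 N (y + of_nat m + 1)"
proof (rule binomial_sum_eqI)
  fix M assume "M < N"
  then have nonzero: "y + of_nat k + 1 \<noteq> 0" if "k \<le> m + M + 1" for k
    using assms[of "Suc k"] that by (simp add: add_ac)
  have "binomial_sum y (weighted_diff y (\<lambda>k. gharm1 k y)) m M = binomial_sum y (\<lambda>k. 1) m M"
    using weighted_diff_gharm[of y _ 1] nonzero by (intro binomial_sum_cong) simp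
  moreover have "weighted_diff (y + of_nat m + 1) (\<lambda>N. gharm1 N (y + of_nat m + 1)) M = 1"
    using weighted_diff_gharm[of "y + of_nat m + 1" M 1] nonzero[of "m + M + 1"]
    by (simp add: add_ac)
  ultimately show "binomial_sum y (weighted_diff y (\<lambda>k. gharm1 k y)) m M
      = ((y + of_nat (m + M) + 1) gchoose M)
        * weighted_diff (y + of_nat m + 1) (\<lambda>N. gharm1 N (y + of_nat m + 1)) M"
    by (simp add: binomial_sum_one)
qed simp

lemma binomial_sum_gharm1_square_minus_gharm2:
  assumes "\<And>k. k \<in> {1..m + N + 1} \<Longrightarrow> y + of_nat k \<noteq> 0"
  shows "binomial_sum y (\<lambda>k. (gharm1 k y)\<^sup>2 - gharm 2 k y) m N
    = ((y + of_nat (m + N) + 1) gchoose N)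
      * ((gharm1 N (y + of_nat m + 1))\<^sup>2 - gharm 2 N (y + of_nat m + 1))"
proof (rule binomial_sum_eqI)
  let ?g = "\<lambda>y k. (gharm1 k y)\<^sup>2 - gharm 2 k y" and ?z = "y + of_nat m + 1"
  fix M assume "M < N"
  then have nonzero: "y + of_nat k + 1 \<noteq> 0" if "k \<le> m + M + 1" for k
    using assms[of "Suc k"] that by (simp add: add_ac)
  have "binomial_sum y (weighted_diff y (?g y)) m M = binomial_sum y (\<lambda>k. 2 * gharm1 k y) m M"
    using weighted_diff_gharm1_square_minus_gharm2 nonzero by (intro binomial_sum_cong) simp
  also have "\<dots> = ((y + of_nat (m + M) + 1) gchoose M) * (2 * gharm1 M ?z)"
    using \<open>M < N\<close> assms by (simp only: binomial_sum_cmult, subst binomial_sum_gharm1) auto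
  also have "2 * gharm1 M ?z = weighted_diff ?z (?g ?z) M"
    using nonzero[of "m + M + 1"]
    by (intro weighted_diff_gharm1_square_minus_gharm2[symmetric]) (simp add: add_ac)
  finally show "binomial_sum y (weighted_diff y (?g y)) m M
      = ((y + of_nat (m + M) + 1) gchoose M) * weighted_diff ?z (?g ?z) M" .
qed simp

section \<open>Reciprocal weights near the diagonal\<close>

abbreviation reciprocal_sum :: "'a \<Rightarrow> nat \<Rightarrow> nat \<Rightarrow> 'a::field_char_0" where
  "reciprocal_sum y \<equiv> binomial_sum y (\<lambda>k. 1 / (y + of_nat k + 1))"

lemma reciprocal_sum_Suc_left:
  assumes "\<And>k. k \<in> {1..N + 1} \<Longrightarrow> y + of_nat k \<noteq> 0"
  shows "of_nat (Suc m) * reciprocal_sum y (Suc m) N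
    = (y + of_nat (m + N) + 2) * reciprocal_sum y m N - ((y + of_nat (m + N) + 1) gchoose N)"
proof -
  have "y + of_nat k + 1 \<noteq> 0" if "k \<le> N" for k
    using assms[of "Suc k"] that by (simp add: add_ac)
  then have "binomial_sum y (\<lambda>k. (y + of_nat k + 1) * (1 / (y + of_nat k + 1))) m N
      = binomial_sum y (\<lambda>k. 1) m N"
    by (intro binomial_sum_cong) simp
  then show ?thesis
    unfolding binomial_sum_Suc_left binomial_sum_one by simp
qed

lemma reciprocal_sum_Suc_Suc:
  assumes "\<And>k. k \<in> {1..N + 2} \<Longrightarrow> y + of_nat k \<noteq> 0"
  shows "(y + of_nat N + 2) * reciprocal_sum y (Suc m) (Suc N)
    = (y + of_nat (m + N) + 3) * reciprocal_sum y (Suc m) N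
      + ((y + of_nat (m + N) + 2) gchoose Suc N)"
proof -
  let ?C = "(y + of_nat (m + N) + 2) gchoose Suc N"
  have "of_nat (Suc m) * reciprocal_sum y (Suc m) (Suc N)
      = (y + of_nat (m + Suc N) + 2) * reciprocal_sum y m (Suc N)
        - ((y + of_nat (m + Suc N) + 1) gchoose Suc N)"
    using assms by (intro reciprocal_sum_Suc_left) simp
  also have "reciprocal_sum y m (Suc N)
      = reciprocal_sum y (Suc m) (Suc N) - reciprocal_sum y (Suc m) N"
    unfolding binomial_sum_Pascal by simp
  finally have "of_nat (Suc m) * reciprocal_sum y (Suc m) (Suc N)
      = (y + of_nat (m + N) + 3) * (reciprocal_sum y (Suc m) (Suc N) - reciprocal_sum y (Suc m) N)
        - ?C"
    by (simp add: add_ac)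
  then have "(y + of_nat (m + N) + 3 - of_nat (Suc m)) * reciprocal_sum y (Suc m) (Suc N)
      = (y + of_nat (m + N) + 3) * reciprocal_sum y (Suc m) N + ?C"
    unfolding left_diff_distrib by (simp only: right_diff_distrib) simp
  then show ?thesis
    by (simp add: add_ac)
qed

lemma reciprocal_sum_subdiagonal_if_diagonal:
  assumes nonzero: "\<And>k. k \<in> {1..2 * n + 2} \<Longrightarrow> y + of_nat k \<noteq> 0"
    and diagonal: "reciprocal_sum y n n
      = ((y + 2 * of_nat n + 1) gchoose n) * alt_harm (2 * n + 1) y"
  shows "reciprocal_sum y (Suc n) n
    = ((y + 2 * of_nat n + 2) gchoose Suc n) * alt_harm (2 * n + 2) y"
proof -
  let ?b = "y + 2 * of_nat n + 1"
  have "?b + 1 \<noteq> 0"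
    using nonzero[of "2 * n + 2"] by (simp add: add_ac)
  have "of_nat (Suc n) * reciprocal_sum y (Suc n) n
      = (y + of_nat (n + n) + 2) * reciprocal_sum y n n - ((y + of_nat (n + n) + 1) gchoose n)"
    using nonzero by (intro reciprocal_sum_Suc_left) simp
  also have "\<dots> = (?b + 1) * ((?b gchoose n) * alt_harm (2 * n + 1) y) - (?b gchoose n)"
    unfolding diagonal by simp
  also have "\<dots> = (?b + 1) * (?b gchoose n) * (alt_harm (2 * n + 1) y - 1 / (?b + 1))"
    using \<open>?b + 1 \<noteq> 0\<close> by (simp add: field_simps)
  also have "\<dots> = of_nat (Suc n) * (((?b + 1) gchoose Suc n) * alt_harm (2 * n + 2) y)"
    unfolding Suc_times_gbinomial[symmetric] alt_harm_even
    by (simp add: mult_ac add_ac del: of_nat_Suc)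
  finally show ?thesis
    by (simp add: add_ac del: of_nat_Suc)
qed

lemma reciprocal_sum_diagonal:
  assumes "\<And>k. k \<in> {1..2 * n + 1} \<Longrightarrow> y + of_nat k \<noteq> 0"
  shows "reciprocal_sum y n n = ((y + 2 * of_nat n + 1) gchoose n) * alt_harm (2 * n + 1) y"
  using assms
proof (induction n)
  case 0
  show ?case
    using alt_harm_odd[of 0 y] by simp
next
  case (Suc n)
  let ?b = "y + 2 * of_nat n + 2"
  have nonzero: "?b + 1 \<noteq> 0" "y + of_nat n + 2 \<noteq> 0"
    using Suc.prems[of "2 * n + 3"] Suc.prems[of "n + 2"] by (simp_all add: add_ac)
  have "reciprocal_sum y (Suc n) n = (?b gchoose Suc n) * alt_harm (2 * n + 2) y"
    using Suc by (intro reciprocal_sum_subdiagonal_if_diagonal) simp_all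
  moreover have "(y + of_nat n + 2) * reciprocal_sum y (Suc n) (Suc n)
      = (y + of_nat (n + n) + 3) * reciprocal_sum y (Suc n) n
        + ((y + of_nat (n + n) + 2) gchoose Suc n)"
    using Suc.prems by (intro reciprocal_sum_Suc_Suc) simp
  ultimately have "(y + of_nat n + 2) * reciprocal_sum y (Suc n) (Suc n)
      = (?b + 1) * ((?b gchoose Suc n) * alt_harm (2 * n + 2) y) + (?b gchoose Suc n)"
    by simp
  also have "\<dots> = (?b + 1) * (?b gchoose Suc n) * (alt_harm (2 * n + 2) y + 1 / (?b + 1))"
    using nonzero by (simp add: field_simps)
  also have "\<dots> = (?b + 1 - of_nat (Suc n)) * ((?b + 1) gchoose Suc n)
      * alt_harm (2 * Suc n + 1) y"
    unfolding gbinomial_absorb_comp alt_harm_odd[of "Suc n"] by (simp add: add_ac)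
  also have "?b + 1 - of_nat (Suc n) = y + of_nat n + 2"
    by simp
  finally show ?case
    using nonzero by (simp add: add_ac)
qed

lemma reciprocal_sum_subdiagonal:
  assumes "\<And>k. k \<in> {1..2 * n + 2} \<Longrightarrow> y + of_nat k \<noteq> 0"
  shows "reciprocal_sum y (Suc n) n
    = ((y + 2 * of_nat n + 2) gchoose Suc n) * alt_harm (2 * n + 2) y"
  using assms
  by (intro reciprocal_sum_subdiagonal_if_diagonal reciprocal_sum_diagonal) auto

section \<open>Second-order harmonic weights near the diagonal\<close>

lemma binomial_sum_weighted_diff_gharm2:
  assumes "\<And>k. k \<in> {1..N + 1} \<Longrightarrow> y + of_nat k \<noteq> 0"
  shows "binomial_sum y (weighted_diff y (\<lambda>k. gharm 2 k y)) m N = reciprocal_sum y m N"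
proof (rule binomial_sum_cong)
  fix k assume "k \<le> N"
  then have "y + of_nat k + 1 \<noteq> 0"
    using assms[of "Suc k"] by (simp add: add_ac)
  then show "weighted_diff y (\<lambda>k. gharm 2 k y) k = 1 / (y + of_nat k + 1)"
    by (simp add: weighted_diff_gharm)
qed

lemma binomial_sum_gharm2_superdiagonal_if_diagonal:
  assumes nonzero: "\<And>k. k \<in> {1..2 * n + 2} \<Longrightarrow> y + of_nat k \<noteq> 0"
    and diagonal: "binomial_sum y (\<lambda>k. gharm 2 k y) n n
      = ((y + 2 * of_nat n + 1) gchoose n) * alt_harm_defect (2 * n + 1) y"
  shows "binomial_sum y (\<lambda>k. gharm 2 k y) n (Suc n)
    = ((y + 2 * of_nat n + 2) gchoose Suc n) * alt_harm_defect (2 * n + 2) y"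
proof -
  let ?b = "y + 2 * of_nat n + 1"
  let ?A = "alt_harm (2 * n + 1) y" and ?E = "alt_harm_defect (2 * n + 1) y"
  have "?b + 1 \<noteq> 0"
    using nonzero[of "2 * n + 2"] by (simp add: add_ac)
  have "binomial_sum y (weighted_diff y (\<lambda>k. gharm 2 k y)) n n = (?b gchoose n) * ?A"
    by (rule trans[OF binomial_sum_weighted_diff_gharm2 reciprocal_sum_diagonal])
      (use nonzero in auto)
  then have "of_nat (Suc n) * binomial_sum y (\<lambda>k. gharm 2 k y) n (Suc n)
      = (?b + 1) * ((?b gchoose n) * ?E) + (?b gchoose n) * ?A"
    unfolding binomial_sum_Suc_right diagonal by (simp add: add_ac)
  also have "\<dots> = (?b + 1) * (?b gchoose n) * (?E + ?A / (?b + 1))"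
    using \<open>?b + 1 \<noteq> 0\<close> by (simp add: field_simps)
  also have "\<dots> = of_nat (Suc n) * (((?b + 1) gchoose Suc n) * alt_harm_defect (2 * n + 2) y)"
    unfolding Suc_times_gbinomial[symmetric] alt_harm_defect_even
    by (simp add: mult_ac add_ac del: of_nat_Suc)
  finally show ?thesis
    by (simp add: add_ac del: of_nat_Suc)
qed

lemma binomial_sum_gharm2_diagonal:
  assumes "\<And>k. k \<in> {1..2 * n + 1} \<Longrightarrow> y + of_nat k \<noteq> 0"
  shows "binomial_sum y (\<lambda>k. gharm 2 k y) n n
    = ((y + 2 * of_nat n + 1) gchoose n) * alt_harm_defect (2 * n + 1) y"
  using assms
proof (induction n)
  case 0
  show ?case
    using alt_harm_defect_odd[of 0 y] by simp
next
  case (Suc n)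
  let ?b = "y + 2 * of_nat n + 2"
  let ?A = "alt_harm (2 * n + 2) y" and ?E = "alt_harm_defect (2 * n + 2) y"
  have nonzero: "?b + 1 \<noteq> 0" "y + of_nat n + 2 \<noteq> 0"
    using Suc.prems[of "2 * n + 3"] Suc.prems[of "n + 2"] by (simp_all add: add_ac)
  have superdiagonal: "binomial_sum y (\<lambda>k. gharm 2 k y) n (Suc n) = (?b gchoose Suc n) * ?E"
    using Suc by (intro binomial_sum_gharm2_superdiagonal_if_diagonal) simp_all
  have "binomial_sum y (weighted_diff y (\<lambda>k. gharm 2 k y)) (Suc n) n = (?b gchoose Suc n) * ?A"
    by (rule trans[OF binomial_sum_weighted_diff_gharm2 reciprocal_sum_subdiagonal])
      (use Suc.prems in auto)
  then have "(y + of_nat n + 2) * binomial_sum y (\<lambda>k. gharm 2 k y) (Suc n) (Suc n)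
      = (?b + 1) * ((?b gchoose Suc n) * ?E) - (?b gchoose Suc n) * ?A"
    unfolding binomial_sum_Suc_Suc superdiagonal by (simp add: add_ac)
  also have "\<dots> = (?b + 1) * (?b gchoose Suc n) * (?E - ?A / (?b + 1))"
    using nonzero by (simp add: field_simps)
  also have "\<dots> = (?b + 1 - of_nat (Suc n)) * ((?b + 1) gchoose Suc n)
      * alt_harm_defect (2 * Suc n + 1) y"
    unfolding gbinomial_absorb_comp alt_harm_defect_odd[of "Suc n"] by (simp add: add_ac)
  also have "?b + 1 - of_nat (Suc n) = y + of_nat n + 2"
    by simp
  finally show ?case
    using nonzero by (simp add: add_ac)
qed

lemma binomial_sum_gharm2_subdiagonal:
  assumes nonzero: "\<And>k. k \<in> {1..2 * n + 2} \<Longrightarrow> y + of_nat k \<noteq> 0"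
  shows "binomial_sum y (\<lambda>k. gharm 2 k y) (Suc n) n
    = ((y + 2 * of_nat n + 2) gchoose n)
      * (alt_harm_defect (2 * n + 2) y - alt_harm (2 * n + 2) y / of_nat (Suc n))"
proof -
  let ?b = "y + 2 * of_nat n + 2"
  let ?A = "alt_harm (2 * n + 2) y" and ?E = "alt_harm_defect (2 * n + 2) y"
  have "y + of_nat n + 2 \<noteq> 0"
    using nonzero[of "n + 2"] by (simp add: add_ac)
  have "(y + of_nat n + 2) * binomial_sum y (\<lambda>k. gharm 2 k y) (Suc n) n
      = of_nat (Suc n) * binomial_sum y (\<lambda>k. gharm 2 k y) n (Suc n)
        - binomial_sum y (weighted_diff y (\<lambda>k. gharm 2 k y)) (Suc n) n"
    unfolding binomial_sum_Suc_exchange by simp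
  also have "binomial_sum y (weighted_diff y (\<lambda>k. gharm 2 k y)) (Suc n) n = (?b gchoose Suc n) * ?A"
    by (rule trans[OF binomial_sum_weighted_diff_gharm2 reciprocal_sum_subdiagonal])
      (use nonzero in auto)
  also have "binomial_sum y (\<lambda>k. gharm 2 k y) n (Suc n) = (?b gchoose Suc n) * ?E"
    using nonzero
    by (intro binomial_sum_gharm2_superdiagonal_if_diagonal binomial_sum_gharm2_diagonal) auto
  also have "of_nat (Suc n) * ((?b gchoose Suc n) * ?E) - (?b gchoose Suc n) * ?A
      = of_nat (Suc n) * (?b gchoose Suc n) * (?E - ?A / of_nat (Suc n))"
    by (simp add: field_simps del: of_nat_Suc)
  also have "of_nat (Suc n) * (?b gchoose Suc n) = (y + of_nat n + 2) * (?b gchoose n)"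
    unfolding gbinomial_absorption gbinomial_absorb_comp[symmetric] by simp
  finally show ?thesis
    using \<open>y + of_nat n + 2 \<noteq> 0\<close> by (simp add: mult.assoc)
qed

section \<open>Squared harmonic weights\<close>

lemma binomial_sum_add_gharm1_square_subdiagonal:
  fixes c y :: complex and n :: nat
  defines "z \<equiv> y + of_nat n + 2"
  assumes nonzero: "\<And>k. k \<in> {1..2 * n + 2} \<Longrightarrow> y + of_nat k \<noteq> 0"
  shows "binomial_sum y (\<lambda>k. (c + gharm1 k y)\<^sup>2) (Suc n) n
    = ((y + 2 * of_nat n + 2) gchoose n)
      * ((c + gharm1 n z)\<^sup>2 - gharm 2 n z
        + alt_harm_defect (2 * n + 2) y - alt_harm (2 * n + 2) y / of_nat (Suc n))"
proof -
  let ?C = "(y + 2 * of_nat n + 2) gchoose n"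
  have arguments: "y + of_nat (Suc n + n) + 1 = y + 2 * of_nat n + 2" "y + of_nat (Suc n) + 1 = z"
    by (simp_all add: z_def)
  have "binomial_sum y (\<lambda>k. (c + gharm1 k y)\<^sup>2) (Suc n) n
      = binomial_sum y (\<lambda>k. c\<^sup>2 * 1 + 2 * c * gharm1 k y
          + ((gharm1 k y)\<^sup>2 - gharm 2 k y) + gharm 2 k y) (Suc n) n"
    by (simp add: power2_sum algebra_simps)
  also have "\<dots> = c\<^sup>2 * ?C + 2 * c * binomial_sum y (\<lambda>k. gharm1 k y) (Suc n) n
      + binomial_sum y (\<lambda>k. (gharm1 k y)\<^sup>2 - gharm 2 k y) (Suc n) n
      + binomial_sum y (\<lambda>k. gharm 2 k y) (Suc n) n"
    unfolding binomial_sum_add binomial_sum_cmult binomial_sum_one arguments ..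
  also have "binomial_sum y (\<lambda>k. gharm1 k y) (Suc n) n = ?C * gharm1 n z"
    unfolding arguments[symmetric] using nonzero by (intro binomial_sum_gharm1) auto
  also have "binomial_sum y (\<lambda>k. (gharm1 k y)\<^sup>2 - gharm 2 k y) (Suc n) n
      = ?C * ((gharm1 n z)\<^sup>2 - gharm 2 n z)"
    unfolding arguments[symmetric] using nonzero
    by (intro binomial_sum_gharm1_square_minus_gharm2) auto
  also have "binomial_sum y (\<lambda>k. gharm 2 k y) (Suc n) n
      = ?C * (alt_harm_defect (2 * n + 2) y - alt_harm (2 * n + 2) y / of_nat (Suc n))"
    using nonzero by (rule binomial_sum_gharm2_subdiagonal)
  finally show ?thesis
    by (simp add: power2_sum algebra_simps)
qed

lemma binomial_sum_index_gharm1_square_diagonal: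
  fixes x :: complex and n :: nat
  defines "z \<equiv> x + of_nat n + 3"
  assumes nonzero: "\<And>k. k \<in> {1..2 * n + 3} \<Longrightarrow> x + of_nat k \<noteq> 0"
  shows "binomial_sum x (\<lambda>k. of_nat k * (gharm1 k x)\<^sup>2) (Suc n) (Suc n)
    = (x + 1) * ((x + 2 * of_nat n + 3) gchoose n)
      * ((1 / (x + 1) + gharm1 n z)\<^sup>2 - gharm 2 n z
        + alt_harm_defect (2 * n + 2) (x + 1) - alt_harm (2 * n + 2) (x + 1) / of_nat (Suc n))"
proof -
  have arguments: "x + 1 + 2 * of_nat n + 2 = x + 2 * of_nat n + 3" "x + 1 + of_nat n + 2 = z"
    by (simp_all add: z_def)
  have "binomial_sum x (\<lambda>k. of_nat k * (gharm1 k x)\<^sup>2) (Suc n) (Suc n)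
      = (x + 1) * binomial_sum (x + 1) (\<lambda>k. (1 / (x + 1) + gharm1 k (x + 1))\<^sup>2) (Suc n) n"
    using gharm_add[of 1 1 _ x] by (simp add: binomial_sum_index_absorb binomial_sum_shift)
  also have "binomial_sum (x + 1) (\<lambda>k. (1 / (x + 1) + gharm1 k (x + 1))\<^sup>2) (Suc n) n
      = ((x + 2 * of_nat n + 3) gchoose n) * ((1 / (x + 1) + gharm1 n z)\<^sup>2 - gharm 2 n z
        + alt_harm_defect (2 * n + 2) (x + 1) - alt_harm (2 * n + 2) (x + 1) / of_nat (Suc n))"
    unfolding arguments[symmetric]
  proof (rule binomial_sum_add_gharm1_square_subdiagonal)
    show "x + 1 + of_nat k \<noteq> 0" if "k \<in> {1..2 * n + 2}" for k
      using nonzero[of "Suc k"] that by (simp add: add_ac)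
  qed
  finally show ?thesis
    by (simp only: mult.assoc)
qed

theorem theorem8:
  fixes x :: complex and n :: nat
  assumes "n \<ge> 1"
    and "\<And>k. k \<in> {1..2 * n + 1} \<Longrightarrow> x + of_nat k \<noteq> 0"
  shows "(\<Sum>k = 0..n. of_nat ((2 * n - k) choose n) * ((x + of_nat k) gchoose k)
              * of_nat k * (gharm1 k x)\<^sup>2)
    = (x + 1) / 8 * ((x + 2 * of_nat n + 1) gchoose (n - 1)) *
      (8 * gharm 2 (n + 2) x - 4 * gharm 2 (2 * n) (x + 1)
       + 8 * (gharm1 (n + 2) x - gharm1 (2 * n + 1) x)
           * (gharm1 (n + 2) x - gharm1 (2 * n + 1) x - 2 / (x + 1))
       - (gharm1 n (x / 2) - gharm1 n ((x + 1) / 2))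
           * (gharm1 n (x / 2) - gharm1 n ((x + 1) / 2) + 4 / of_nat n))"
proof -
  obtain m where n: "n = Suc m"
    using assms(1) by (cases n) auto
  define r z a where "r = 1 / (x + 1)" and "z = x + of_nat m + 3"
    and "a = alt_harm (2 * n) (x + 1)"
  have "(\<Sum>k = 0..n. of_nat ((2 * n - k) choose n) * ((x + of_nat k) gchoose k)
      * of_nat k * (gharm1 k x)\<^sup>2) = binomial_sum x (\<lambda>k. of_nat k * (gharm1 k x)\<^sup>2) n n"
    by (simp add: binomial_sum_def atMost_atLeast0 mult_2 mult.assoc)
  also have "\<dots> = (x + 1) * ((x + 2 * of_nat n + 1) gchoose (n - 1))
      * ((r + gharm1 m z)\<^sup>2 - gharm 2 m z + (gharm 2 (2 * n) (x + 1) - a\<^sup>2) / 2 - a / of_nat n)"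
    using binomial_sum_index_gharm1_square_diagonal[of m x] assms(2)
    by (simp add: n r_def z_def a_def alt_harm_defect_def add_ac distrib_left)
  finally have closed_form:
    "(\<Sum>k = 0..n. of_nat ((2 * n - k) choose n) * ((x + of_nat k) gchoose k)
        * of_nat k * (gharm1 k x)\<^sup>2) = \<dots>" .
  have "gharm1 (2 * n + 1) x = gharm1 (n + 2) x + gharm1 m z"
    using gharm_add[of 1 "n + 2" m x] by (simp add: n z_def add_ac mult_2)
  moreover have "gharm 2 (n + 2) x = r\<^sup>2 + gharm 2 (2 * n) (x + 1) - gharm 2 m z"
    using gharm_add[of 2 1 "n + 1" x] gharm_add[of 2 "n + 1" m "x + 1"]
    by (simp add: n z_def r_def power_divide add_ac mult_2)
  moreover have "2 / (x + 1) = 2 * r"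
    by (simp add: r_def)
  moreover have "y * c * ((r + h)\<^sup>2 - h' + (g - a\<^sup>2) / 2 - a / d)
      = y / 8 * c * (8 * (r\<^sup>2 + g - h') - 4 * g + 8 * (k - (k + h)) * (k - (k + h) - 2 * r)
        - 2 * a * (2 * a + 4 / d))" for y c h h' g d k :: complex
    by (simp add: field_simps power2_eq_square)
  ultimately show ?thesis
    unfolding closed_form gharm1_half_diff a_def[symmetric] by (simp only:)
qed

end
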